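(* Let $n\ge 2$, let $\mathbb{K}$ be a field of characteristic zero containing a primitive $n$th root of unity $q$, let $B=\mathbb{K}\mathbb{Z}_n$ be the group Hopf algebra of the cyclic group $\mathbb{Z}_n=\langle x: x^n=1\rangle$, with antipode $S$, and for $0\le k<n$ set $e_k=\frac1n\sum_{i=0}^{n-1}q^{-ik}x^i$. Then $$J=\sum_{k=0}^{n-1}e_k\otimes x^k\in B\otimes B$$ is a twist for $B$ such that (i) $(e_1^2\otimes e_2^2)(J)$ is a twist for $B\otimes B$; (ii) $\Delta_{B\otimes B}(J)=(e_1^2\otimes e_2^2)(J)\,(e_2^2\otimes e_1^2)(J)\,(J\otimes J)$; (iii) $(S\otimes S)(J)=J$ and $(\mathrm{id}\otimes S)(J)=J^{-1}=(S\otimes\mathrm{id})(J)$.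
   Context: Twist: an invertible element $J\in B\otimes B$ of a bialgebra $B$ is a twist for $B$ if $(\Delta_B\otimes\mathrm{id}_B)(J)(J\otimes 1_B)=(\mathrm{id}_B\otimes\Delta_B)(J)(1_B\otimes J)$ and $(\epsilon\otimes\mathrm{id})(J)=1=(\mathrm{id}\otimes\epsilon)(J)$. The maps $e_1^2,e_2^2:B\to B\otimes B$ (not to be confused with the idempotents $e_k$) are $e_1^2(b)=b\otimes 1$ and $e_2^2(b)=1\otimes b$. The bialgebra $B\otimes B$ carries the usual tensor product structure, so $\Delta_{B\otimes B}:B\otimes B\to(B\otimes B)\otimes(B\otimes B)$ is $(\mathrm{id}\otimes\tau\otimes\mathrm{id})(\Delta_B\otimes\Delta_B)$ with $\tau$ the flip. *)

theory Defs
  imports Complex_Main "HOL-Library.Poly_Mapping"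
begin

section \<open>Vector spaces and tensor products\<close>

text \<open>
  A vector space over \<open>'k\<close> with basis \<open>'x\<close> is the type \<open>'x \<Rightarrow>\<^sub>0 'k\<close> of finitely supported
  functions; the basis vectors are \<open>Poly_Mapping.single a 1\<close>. Since every vector space over a field
  has a basis, this is no restriction up to isomorphism.
\<close>

definition scl :: "'k::field \<Rightarrow> ('x \<Rightarrow>\<^sub>0 'k) \<Rightarrow> ('x \<Rightarrow>\<^sub>0 'k)" (infixr \<open>*\<^sub>k\<close> 75)
  where "c *\<^sub>k p = Poly_Mapping.map ((*) c) p"

abbreviation basis_vec :: "'x \<Rightarrow> ('x \<Rightarrow>\<^sub>0 'k::field)"
  where "basis_vec a \<equiv> Poly_Mapping.single a 1"

text \<open>The linear extension of a map on the basis, into a vector space with scalar action \<open>s\<close>.\<close>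

definition lin_ext ::
    "('k::field \<Rightarrow> 'c \<Rightarrow> 'c::ab_group_add) \<Rightarrow> ('x \<Rightarrow> 'c) \<Rightarrow> ('x \<Rightarrow>\<^sub>0 'k) \<Rightarrow> 'c"
  where "lin_ext s f p =
    (\<Sum>a\<in>Poly_Mapping.keys p. s (Poly_Mapping.lookup p a) (f a))"

text \<open>
  The tensor product of \<open>'x \<Rightarrow>\<^sub>0 'k\<close> and \<open>'y \<Rightarrow>\<^sub>0 'k\<close> is \<open>'x \<times> 'y \<Rightarrow>\<^sub>0 'k\<close> with the following
  pure tensors; its universal property is the lemma \<open>tensor_universal\<close> below.
\<close>

lift_definition tens ::
    "('x \<Rightarrow>\<^sub>0 'k::field) \<Rightarrow> ('y \<Rightarrow>\<^sub>0 'k) \<Rightarrow> ('x \<times> 'y \<Rightarrow>\<^sub>0 'k)" (infixr \<open>\<otimes>\<close> 70)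
  is "\<lambda>u v (a, b). u a * v b"
proof -
  fix u :: "'x \<Rightarrow> 'k" and v :: "'y \<Rightarrow> 'k"
  assume "finite {a. u a \<noteq> 0}" "finite {b. v b \<noteq> 0}"
  then have "finite ({a. u a \<noteq> 0} \<times> {b. v b \<noteq> 0})" by simp
  then show "finite {x. (case x of (a, b) \<Rightarrow> u a * v b) \<noteq> 0}"
    by (rule rev_finite_subset) auto
qed

text \<open>The linear map on the tensor product induced by a bilinear map \<open>\<beta>\<close>.\<close>

definition tlift ::
    "('k::field \<Rightarrow> 'c \<Rightarrow> 'c::ab_group_add) \<Rightarrow> (('x \<Rightarrow>\<^sub>0 'k) \<Rightarrow> ('y \<Rightarrow>\<^sub>0 'k) \<Rightarrow> 'c)
      \<Rightarrow> ('x \<times> 'y \<Rightarrow>\<^sub>0 'k) \<Rightarrow> 'c"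
  where "tlift s \<beta> = lin_ext s (\<lambda>(a, b). \<beta> (basis_vec a) (basis_vec b))"

lemma lookup_scl [simp]: "Poly_Mapping.lookup (c *\<^sub>k p) a = c * Poly_Mapping.lookup p a"
  unfolding scl_def by (simp add: Poly_Mapping.map.rep_eq when_def)

lemma lookup_tens [simp]:
  "Poly_Mapping.lookup (u \<otimes> v) (a, b) = Poly_Mapping.lookup u a * Poly_Mapping.lookup v b"
  by (simp add: tens.rep_eq)

lemma vector_space_scl: "vector_space (scl :: 'k::field \<Rightarrow> ('x \<Rightarrow>\<^sub>0 'k) \<Rightarrow> _)"
  by standard (auto intro!: poly_mapping_eqI simp: lookup_add algebra_simps)

lemma vector_space_field: "vector_space ((*) :: 'k::field \<Rightarrow> 'k \<Rightarrow> 'k)"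
  by standard (auto simp: algebra_simps)

lemma lin_ext_superset:
  assumes "vector_space s" "finite A" "Poly_Mapping.keys p \<subseteq> A"
  shows "lin_ext s f p = (\<Sum>a\<in>A. s (Poly_Mapping.lookup p a) (f a))"
proof -
  interpret vector_space s by fact
  show ?thesis unfolding lin_ext_def
    by (rule sum.mono_neutral_left) (use assms in \<open>auto simp: in_keys_iff\<close>)
qed

lemma linear_lin_ext:
  assumes "vector_space s"
  shows "Vector_Spaces.linear scl s (lin_ext s f)"
proof -
  interpret vector_space s by fact
  show ?thesis unfolding Vector_Spaces.linear_iff
  proof (intro conjI allI)
    show "vector_space s" "vector_space (scl :: 'a \<Rightarrow> ('c \<Rightarrow>\<^sub>0 'a) \<Rightarrow> _)"
      by (fact assms, rule vector_space_scl)
    show "lin_ext s f (p + p') = lin_ext s f p + lin_ext s f p'" for p p' :: "'c \<Rightarrow>\<^sub>0 'a"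
    proof -
      let ?A = "Poly_Mapping.keys p \<union> Poly_Mapping.keys p'"
      have "Poly_Mapping.keys (p + p') \<subseteq> ?A" by (rule Poly_Mapping.keys_add)
      then show ?thesis
        by (simp add: lin_ext_superset[OF assms, of ?A] lookup_add scale_left_distrib sum.distrib)
    qed
    show "lin_ext s f (c *\<^sub>k p) = s c (lin_ext s f p)" for c and p :: "'c \<Rightarrow>\<^sub>0 'a"
    proof -
      have "Poly_Mapping.keys (c *\<^sub>k p) \<subseteq> Poly_Mapping.keys p"
        by (auto simp: in_keys_iff)
      then show ?thesis
        by (simp add: lin_ext_superset[OF assms, of "Poly_Mapping.keys p"] scale_sum_right)
    qed
  qed
qed

lemma lin_ext_basis_vec [simp]:
  assumes "vector_space s"
  shows "lin_ext s f (basis_vec a) = f a"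
proof -
  interpret vector_space s by fact
  show ?thesis by (simp add: lin_ext_def)
qed

lemma lin_ext_basis_expansion: "lin_ext scl basis_vec p = p"
proof (rule poly_mapping_eqI)
  fix a
  have "Poly_Mapping.lookup (lin_ext scl basis_vec p) a =
      (\<Sum>b\<in>Poly_Mapping.keys p. if b = a then Poly_Mapping.lookup p b else 0)"
    unfolding lin_ext_def lookup_sum
    by (rule sum.cong) (auto simp: lookup_single when_def)
  also have "\<dots> = Poly_Mapping.lookup p a"
    by (simp add: in_keys_iff)
  finally show "Poly_Mapping.lookup (lin_ext scl basis_vec p) a = Poly_Mapping.lookup p a" .
qed

lemma linear_eq_lin_ext:
  assumes "Vector_Spaces.linear scl s T"
  shows "T p = lin_ext s (\<lambda>a. T (basis_vec a)) p"
proof -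
  interpret T: Vector_Spaces.linear scl s T by fact
  have "T p = T (lin_ext scl basis_vec p)" by (simp add: lin_ext_basis_expansion)
  also have "\<dots> = lin_ext s (\<lambda>a. T (basis_vec a)) p"
    unfolding lin_ext_def by (simp add: T.sum T.scale)
  finally show ?thesis .
qed

lemma linear_eqI:
  assumes "Vector_Spaces.linear scl s T" "Vector_Spaces.linear scl s T'"
    and "\<And>a. T (basis_vec a) = T' (basis_vec a)"
  shows "T p = T' p"
  unfolding linear_eq_lin_ext[OF assms(1), of p] linear_eq_lin_ext[OF assms(2), of p]
  by (simp only: assms(3))

lemma tens_basis_vec: "basis_vec a \<otimes> basis_vec b = basis_vec (a, b)"
  by (rule poly_mapping_eqI) (auto simp: lookup_single when_def split: if_splits)

lemma linear_tens_left: "Vector_Spaces.linear scl scl (\<lambda>u. u \<otimes> v)"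
  and linear_tens_right: "Vector_Spaces.linear scl scl (\<lambda>v. u \<otimes> v)"
  unfolding Vector_Spaces.linear_iff
  by (auto intro!: poly_mapping_eqI vector_space_scl simp: lookup_add algebra_simps)

theorem tensor_universal:
  fixes \<beta> :: "('x \<Rightarrow>\<^sub>0 'k::field) \<Rightarrow> ('y \<Rightarrow>\<^sub>0 'k) \<Rightarrow> 'c::ab_group_add"
  assumes lin1: "\<And>v. Vector_Spaces.linear scl s (\<lambda>u. \<beta> u v)"
    and lin2: "\<And>u. Vector_Spaces.linear scl s (\<lambda>v. \<beta> u v)"
  shows "Vector_Spaces.linear scl s T \<and> (\<forall>u v. T (u \<otimes> v) = \<beta> u v) \<longleftrightarrow> T = tlift s \<beta>"
proof
  have s: "vector_space s" using lin1 unfolding Vector_Spaces.linear_iff by blast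
  show "T = tlift s \<beta>" if "Vector_Spaces.linear scl s T \<and> (\<forall>u v. T (u \<otimes> v) = \<beta> u v)"
  proof
    fix p
    have "T (basis_vec ab) = (case ab of (a, b) \<Rightarrow> \<beta> (basis_vec a) (basis_vec b))" for ab
      using that by (cases ab) (simp flip: tens_basis_vec)
    then show "T p = tlift s \<beta> p"
      unfolding tlift_def using that by (subst linear_eq_lin_ext[of s T p]) simp_all
  qed
  show "Vector_Spaces.linear scl s T \<and> (\<forall>u v. T (u \<otimes> v) = \<beta> u v)" if T: "T = tlift s \<beta>"
  proof (intro conjI allI)
    show lin: "Vector_Spaces.linear scl s T"
      unfolding T tlift_def by (rule linear_lin_ext[OF s])
    fix u v
    have l: "Vector_Spaces.linear scl s (\<lambda>u. T (u \<otimes> v))" for v :: "'y \<Rightarrow>\<^sub>0 'k"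
      using Vector_Spaces.linear_compose[OF linear_tens_left lin] by (simp add: o_def)
    have r: "Vector_Spaces.linear scl s (\<lambda>v. T (u \<otimes> v))" for u :: "'x \<Rightarrow>\<^sub>0 'k"
      using Vector_Spaces.linear_compose[OF linear_tens_right lin] by (simp add: o_def)
    show "T (u \<otimes> v) = \<beta> u v"
    proof (rule linear_eqI[OF l lin1])
      fix a
      show "T (basis_vec a \<otimes> v) = \<beta> (basis_vec a) v"
        by (rule linear_eqI[OF r lin2])
          (simp add: tens_basis_vec T tlift_def lin_ext_basis_vec[OF s])
    qed
  qed
qed

definition tmap ::
    "(('x \<Rightarrow>\<^sub>0 'k::field) \<Rightarrow> ('y \<Rightarrow>\<^sub>0 'k)) \<Rightarrow> (('z \<Rightarrow>\<^sub>0 'k) \<Rightarrow> ('w \<Rightarrow>\<^sub>0 'k))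
      \<Rightarrow> ('x \<times> 'z \<Rightarrow>\<^sub>0 'k) \<Rightarrow> ('y \<times> 'w \<Rightarrow>\<^sub>0 'k)"
  where "tmap f g = tlift scl (\<lambda>u v. f u \<otimes> g v)"

definition tassoc :: "(('x \<times> 'y) \<times> 'z \<Rightarrow>\<^sub>0 'k::field) \<Rightarrow> ('x \<times> ('y \<times> 'z) \<Rightarrow>\<^sub>0 'k)"
  where "tassoc = tlift scl (\<lambda>s w. tlift scl (\<lambda>u v. u \<otimes> (v \<otimes> w)) s)"

text \<open>\<open>id \<otimes> \<tau> \<otimes> id\<close>, i.e. \<open>(u \<otimes> u') \<otimes> (v \<otimes> v') \<mapsto> (u \<otimes> v) \<otimes> (u' \<otimes> v')\<close>.\<close>

definition mid_flip ::
    "(('x \<times> 'x) \<times> ('y \<times> 'y) \<Rightarrow>\<^sub>0 'k::field) \<Rightarrow> (('x \<times> 'y) \<times> ('x \<times> 'y) \<Rightarrow>\<^sub>0 'k)"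
  where "mid_flip = tlift scl (\<lambda>s t.
    tlift scl (\<lambda>u u'. tlift scl (\<lambda>v v'. (u \<otimes> v) \<otimes> (u' \<otimes> v')) t) s)"

section \<open>Bialgebras and twists\<close>

record (overloaded) ('x, 'k) bialg =
  bmult :: "('x \<Rightarrow>\<^sub>0 'k) \<Rightarrow> ('x \<Rightarrow>\<^sub>0 'k) \<Rightarrow> ('x \<Rightarrow>\<^sub>0 'k)"  (infixl \<open>\<cdot>\<index>\<close> 70)
  bunit :: "'x \<Rightarrow>\<^sub>0 'k"  (\<open>\<one>\<index>\<close>)
  bcomult :: "('x \<Rightarrow>\<^sub>0 'k) \<Rightarrow> ('x \<times> 'x \<Rightarrow>\<^sub>0 'k)"
  bcounit :: "('x \<Rightarrow>\<^sub>0 'k) \<Rightarrow> 'k"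

definition tensor_bialg ::
    "('x, 'k::field) bialg \<Rightarrow> ('y, 'k) bialg \<Rightarrow> ('x \<times> 'y, 'k) bialg" (infixr \<open>\<otimes>\<^sub>B\<close> 70)
  where "A \<otimes>\<^sub>B B = \<lparr>
    bmult = (\<lambda>s t. tlift scl (\<lambda>a b. tlift scl (\<lambda>c d. (a \<cdot>\<^bsub>A\<^esub> c) \<otimes> (b \<cdot>\<^bsub>B\<^esub> d)) t) s),
    bunit = \<one>\<^bsub>A\<^esub> \<otimes> \<one>\<^bsub>B\<^esub>,
    bcomult = (\<lambda>t. mid_flip (tmap (bcomult A) (bcomult B) t)),
    bcounit = tlift (*) (\<lambda>a b. bcounit A a * bcounit B b) \<rparr>"

locale bialgebra =
  fixes B :: "('x, 'k::field) bialg" (structure)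
  assumes mult_linear_left: "Vector_Spaces.linear scl scl (\<lambda>a. a \<cdot> b)"
    and mult_linear_right: "Vector_Spaces.linear scl scl (\<lambda>b. a \<cdot> b)"
    and mult_assoc: "(a \<cdot> b) \<cdot> c = a \<cdot> (b \<cdot> c)"
    and unit_left: "\<one> \<cdot> a = a"
    and unit_right: "a \<cdot> \<one> = a"
    and comult_linear: "Vector_Spaces.linear scl scl (bcomult B)"
    and counit_linear: "Vector_Spaces.linear scl (*) (bcounit B)"
    and coassoc: "tassoc (tmap (bcomult B) id (bcomult B a)) = tmap id (bcomult B) (bcomult B a)"
    and counit_left: "tlift scl (\<lambda>u v. bcounit B u *\<^sub>k v) (bcomult B a) = a"
    and counit_right: "tlift scl (\<lambda>u v. bcounit B v *\<^sub>k u) (bcomult B a) = a"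
    and comult_mult: "bcomult B (a \<cdot> b) = bcomult B a \<cdot>\<^bsub>B \<otimes>\<^sub>B B\<^esub> bcomult B b"
    and comult_unit: "bcomult B \<one> = \<one>\<^bsub>B \<otimes>\<^sub>B B\<^esub>"
    and counit_mult: "bcounit B (a \<cdot> b) = bcounit B a * bcounit B b"
    and counit_unit: "bcounit B \<one> = 1"

locale hopf_algebra = bialgebra B
  for B :: "('x, 'k::field) bialg" (structure) +
  fixes S :: "('x \<Rightarrow>\<^sub>0 'k) \<Rightarrow> ('x \<Rightarrow>\<^sub>0 'k)"
  assumes antipode_linear: "Vector_Spaces.linear scl scl S"
    and antipode_left: "tlift scl (\<lambda>u v. S u \<cdot> v) (bcomult B a) = bcounit B a *\<^sub>k \<one>"
    and antipode_right: "tlift scl (\<lambda>u v. u \<cdot> S v) (bcomult B a) = bcounit B a *\<^sub>k \<one>"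

definition is_inverse :: "('x, 'k::field) bialg \<Rightarrow> ('x \<Rightarrow>\<^sub>0 'k) \<Rightarrow> ('x \<Rightarrow>\<^sub>0 'k) \<Rightarrow> bool"
  where "is_inverse A a b \<longleftrightarrow> a \<cdot>\<^bsub>A\<^esub> b = \<one>\<^bsub>A\<^esub> \<and> b \<cdot>\<^bsub>A\<^esub> a = \<one>\<^bsub>A\<^esub>"

text \<open>
  The two sides of the cocycle condition live in \<open>(B \<otimes> B) \<otimes> B\<close> and \<open>B \<otimes> (B \<otimes> B)\<close> and are
  compared along \<open>tassoc\<close>. Likewise \<open>\<epsilon> \<otimes> id\<close> and \<open>id \<otimes> \<epsilon>\<close> take values in \<open>B\<close>, identified with
  its tensor products with the ground field.
\<close>

locale twist = bialgebra B
  for B :: "('x, 'k::field) bialg" (structure) +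
  fixes J :: "'x \<times> 'x \<Rightarrow>\<^sub>0 'k"
  assumes invertible: "\<exists>J'. is_inverse (B \<otimes>\<^sub>B B) J J'"
    and cocycle:
      "tassoc (tmap (bcomult B) id J \<cdot>\<^bsub>(B \<otimes>\<^sub>B B) \<otimes>\<^sub>B B\<^esub> (J \<otimes> \<one>)) =
        tmap id (bcomult B) J \<cdot>\<^bsub>B \<otimes>\<^sub>B (B \<otimes>\<^sub>B B)\<^esub> (\<one> \<otimes> J)"
    and counital_left: "tlift scl (\<lambda>u v. bcounit B u *\<^sub>k v) J = \<one>"
    and counital_right: "tlift scl (\<lambda>u v. bcounit B v *\<^sub>k u) J = \<one>"

section \<open>Group Hopf algebras and roots of unity\<close>

text \<open>
  Groups are written additively because the product of \<^typ>\<open>'g \<Rightarrow>\<^sub>0 'k\<close> in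
  \<^theory>\<open>HOL-Library.Poly_Mapping\<close> is convolution with respect to addition on \<^typ>\<open>'g\<close>. The
  group element \<open>g\<close>, seen in the group algebra, is \<^term>\<open>basis_vec g\<close>.
\<close>

definition group_algebra :: "('g::group_add, 'k::field) bialg"
  where "group_algebra = \<lparr>
    bmult = (*),
    bunit = 1,
    bcomult = lin_ext scl (\<lambda>g. basis_vec g \<otimes> basis_vec g),
    bcounit = lin_ext (*) (\<lambda>g. 1) \<rparr>"

definition group_antipode :: "('g::group_add \<Rightarrow>\<^sub>0 'k::field) \<Rightarrow> ('g \<Rightarrow>\<^sub>0 'k)"
  where "group_antipode = lin_ext scl (\<lambda>g. basis_vec (- g))"

lemma times_scl_left: "(c *\<^sub>k a) * b = c *\<^sub>k (a * b :: 'g::monoid_add \<Rightarrow>\<^sub>0 'k::field)"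
  unfolding scl_def mult_map_scale_conv_mult by (simp add: mult.assoc)

lemma single_zero_commute:
  "Poly_Mapping.single 0 c * a = a * Poly_Mapping.single 0 c"
  for a :: "'g::monoid_add \<Rightarrow>\<^sub>0 'k::field"
proof -
  have l: "Poly_Mapping.single 0 c * p = c *\<^sub>k p" for p :: "'g \<Rightarrow>\<^sub>0 'k"
    by (simp add: scl_def mult_map_scale_conv_mult)
  have "a * Poly_Mapping.single 0 c = lin_ext scl basis_vec a * Poly_Mapping.single 0 c"
    by (simp add: lin_ext_basis_expansion)
  also have "\<dots> = (\<Sum>h\<in>Poly_Mapping.keys a.
      Poly_Mapping.lookup a h *\<^sub>k Poly_Mapping.single h 1 * Poly_Mapping.single 0 c)"
    by (simp add: lin_ext_def sum_distrib_right)
  also have "\<dots> = (\<Sum>h\<in>Poly_Mapping.keys a.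
      Poly_Mapping.single 0 c * (Poly_Mapping.lookup a h *\<^sub>k Poly_Mapping.single h 1))"
    by (rule sum.cong) (simp_all add: scl_def mult_map_scale_conv_mult mult_single mult.commute)
  also have "\<dots> = Poly_Mapping.single 0 c * lin_ext scl basis_vec a"
    by (simp add: lin_ext_def sum_distrib_left)
  finally show ?thesis by (simp add: lin_ext_basis_expansion)
qed

lemma times_scl_right: "a * (c *\<^sub>k b) = c *\<^sub>k (a * b :: 'g::monoid_add \<Rightarrow>\<^sub>0 'k::field)"
  unfolding scl_def mult_map_scale_conv_mult
  by (simp only: mult.assoc[symmetric] single_zero_commute[of c a])

lemma linear_times_left:
    "Vector_Spaces.linear scl scl (\<lambda>a. a * b :: 'g::monoid_add \<Rightarrow>\<^sub>0 'k::field)"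
  and linear_times_right:
    "Vector_Spaces.linear scl scl (\<lambda>b. a * b :: 'g::monoid_add \<Rightarrow>\<^sub>0 'k::field)"
  unfolding Vector_Spaces.linear_iff
  by (simp_all add: vector_space_scl distrib_left distrib_right times_scl_left times_scl_right)

lemma linear_tlift: "vector_space s \<Longrightarrow> Vector_Spaces.linear scl s (tlift s \<beta>)"
  unfolding tlift_def by (rule linear_lin_ext)

lemma tlift_basis_vec [simp]:
  "vector_space s \<Longrightarrow> tlift s \<beta> (basis_vec (a, b)) = \<beta> (basis_vec a) (basis_vec b)"
  by (simp add: tlift_def)

lemma basis_vec_mult: "basis_vec g * basis_vec h = (basis_vec (g + h) :: 'g::monoid_add \<Rightarrow>\<^sub>0 'k::field)"
  by (simp add: mult_single)

lemma tensor_bialg_mult_tens: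
  assumes "bialgebra A" "bialgebra B"
  shows "(a \<otimes> b) \<cdot>\<^bsub>A \<otimes>\<^sub>B B\<^esub> (c \<otimes> d) = (a \<cdot>\<^bsub>A\<^esub> c) \<otimes> (b \<cdot>\<^bsub>B\<^esub> d)"
proof -
  interpret A: bialgebra A by fact
  interpret B: bialgebra B by fact
  note comp = Vector_Spaces.linear_compose[unfolded o_def]
  have 1: "tlift scl (\<lambda>c d. (a \<cdot>\<^bsub>A\<^esub> c) \<otimes> (b \<cdot>\<^bsub>B\<^esub> d)) (c \<otimes> d) = (a \<cdot>\<^bsub>A\<^esub> c) \<otimes> (b \<cdot>\<^bsub>B\<^esub> d)"
    for a b c d
    using tensor_universal[of scl "\<lambda>c d. (a \<cdot>\<^bsub>A\<^esub> c) \<otimes> (b \<cdot>\<^bsub>B\<^esub> d)"]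
      comp[OF A.mult_linear_right linear_tens_left] comp[OF B.mult_linear_right linear_tens_right]
    by blast
  have "tlift scl (\<lambda>a b. (a \<cdot>\<^bsub>A\<^esub> c) \<otimes> (b \<cdot>\<^bsub>B\<^esub> d)) (a \<otimes> b) = (a \<cdot>\<^bsub>A\<^esub> c) \<otimes> (b \<cdot>\<^bsub>B\<^esub> d)"
    using tensor_universal[of scl "\<lambda>a b. (a \<cdot>\<^bsub>A\<^esub> c) \<otimes> (b \<cdot>\<^bsub>B\<^esub> d)"]
      comp[OF A.mult_linear_left linear_tens_left] comp[OF B.mult_linear_left linear_tens_right]
    by blast
  then show ?thesis
    by (simp add: tensor_bialg_def 1)
qed

lemma bilinear_eqI:
  assumes "\<And>b. Vector_Spaces.linear scl s (\<lambda>a. F a b)" "\<And>b. Vector_Spaces.linear scl s (\<lambda>a. G a b)"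
    and "\<And>a. Vector_Spaces.linear scl s (\<lambda>b. F a b)" "\<And>a. Vector_Spaces.linear scl s (\<lambda>b. G a b)"
    and "\<And>g h. F (basis_vec g) (basis_vec h) = G (basis_vec g) (basis_vec h)"
  shows "F p q = G p q"
proof (rule linear_eqI[of s "\<lambda>a. F a q" "\<lambda>a. G a q"])
  show "F (basis_vec g) q = G (basis_vec g) q" for g
    by (rule linear_eqI[of s "F (basis_vec g)" "G (basis_vec g)"]) (use assms in auto)
qed (use assms in auto)

lemma linear_tlift_param:
  assumes "vector_space s" "vector_space s'"
    and "\<And>g h. Vector_Spaces.linear s' s (\<lambda>t. \<beta> t (basis_vec g) (basis_vec h))"
  shows "Vector_Spaces.linear s' s (\<lambda>t. tlift s (\<beta> t) p)"
proof -
  interpret vector_space s by fact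
  have \<beta>: "\<beta> (t + t') (basis_vec g) (basis_vec h) =
        \<beta> t (basis_vec g) (basis_vec h) + \<beta> t' (basis_vec g) (basis_vec h)"
      "\<beta> (s' c t) (basis_vec g) (basis_vec h) = s c (\<beta> t (basis_vec g) (basis_vec h))"
    for t t' c g h
    using assms(3)[of g h] unfolding Vector_Spaces.linear_iff by blast+
  show ?thesis
    unfolding Vector_Spaces.linear_iff
    by (simp add: assms \<beta> tlift_def lin_ext_def case_prod_unfold scale_right_distrib
        sum.distrib scale_sum_right mult.commute)
qed

lemma linear_ident_scl: "Vector_Spaces.linear scl scl (\<lambda>a :: 'x \<Rightarrow>\<^sub>0 'k::field. a)"
  by (simp add: Vector_Spaces.linear_iff vector_space_scl)

lemma one_scl [simp]: "1 *\<^sub>k a = a"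
  by (rule poly_mapping_eqI) simp

lemma linear_mult_functional:
  fixes h :: "('x \<Rightarrow>\<^sub>0 'k::field) \<Rightarrow> 'k"
  assumes "Vector_Spaces.linear scl (*) h"
  shows "Vector_Spaces.linear scl (*) (\<lambda>a. h a * c)" "Vector_Spaces.linear scl (*) (\<lambda>a. c * h a)"
    "Vector_Spaces.linear scl scl (\<lambda>a. h a *\<^sub>k v)"
  using assms unfolding Vector_Spaces.linear_iff
  by (auto intro!: poly_mapping_eqI vector_space_scl simp: lookup_add algebra_simps)

theorem hopf_algebra_group_algebra:
  "hopf_algebra (group_algebra :: ('g::group_add, 'k::field) bialg) group_antipode"
proof -
  note comp = Vector_Spaces.linear_compose[unfolded o_def]
  note vs = vector_space_scl vector_space_field
  note lin = linear_lin_ext[OF vector_space_scl]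
  note lin' = linear_lin_ext[OF vector_space_field]
  note tl = linear_tlift[OF vector_space_scl]
  note [simp] = lin lin' tl linear_ident_scl
  let ?B = "group_algebra :: ('g, 'k) bialg"
  have B: "bmult ?B = (*)" "bunit ?B = 1" "bcomult ?B = lin_ext scl (\<lambda>g. basis_vec (g, g))"
      "bcounit ?B = lin_ext (*) (\<lambda>g. 1)"
    by (simp_all add: group_algebra_def tens_basis_vec)
  have one: "(1 :: 'g \<Rightarrow>\<^sub>0 'k) = basis_vec 0" by simp
  have T2: "Vector_Spaces.linear scl scl (bmult (?B \<otimes>\<^sub>B ?B) s)" for s
    unfolding tensor_bialg_def bialg.simps B
    by (rule linear_tlift_param[OF vector_space_scl vector_space_scl tl])
  show ?thesis
  proof (intro hopf_algebra.intro bialgebra.intro hopf_algebra_axioms.intro)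
    fix a b c :: "'g \<Rightarrow>\<^sub>0 'k"
    show "Vector_Spaces.linear scl scl (\<lambda>a. a \<cdot>\<^bsub>?B\<^esub> b)" "Vector_Spaces.linear scl scl (\<lambda>b. a \<cdot>\<^bsub>?B\<^esub> b)"
      by (simp_all add: B linear_times_left linear_times_right)
    show "(a \<cdot>\<^bsub>?B\<^esub> b) \<cdot>\<^bsub>?B\<^esub> c = a \<cdot>\<^bsub>?B\<^esub> (b \<cdot>\<^bsub>?B\<^esub> c)" "\<one>\<^bsub>?B\<^esub> \<cdot>\<^bsub>?B\<^esub> a = a" "a \<cdot>\<^bsub>?B\<^esub> \<one>\<^bsub>?B\<^esub> = a"
      by (simp_all add: B mult.assoc)
    show "Vector_Spaces.linear scl scl (bcomult ?B)" "Vector_Spaces.linear scl (*) (bcounit ?B)"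
      by (simp_all add: B)
    show "tassoc (tmap (bcomult ?B) id (bcomult ?B a)) = tmap id (bcomult ?B) (bcomult ?B a)"
      unfolding tassoc_def tmap_def B
      by (rule linear_eqI[of scl "\<lambda>a. tlift scl _ (tlift scl _ (lin_ext scl _ a))"])
        (auto intro!: comp[OF lin] comp[OF tl] simp: vs tens_basis_vec)
    show "tlift scl (\<lambda>u v. bcounit ?B u *\<^sub>k v) (bcomult ?B a) = a"
      "tlift scl (\<lambda>u v. bcounit ?B v *\<^sub>k u) (bcomult ?B a) = a"
      unfolding B
      by (rule linear_eqI[of scl "\<lambda>a. tlift scl _ (lin_ext scl _ a)" "\<lambda>a. a"];
          auto intro!: comp[OF lin] simp: vs)+
    show "bcomult ?B (a \<cdot>\<^bsub>?B\<^esub> b) = bcomult ?B a \<cdot>\<^bsub>?B \<otimes>\<^sub>B ?B\<^esub> bcomult ?B b"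
    proof (rule bilinear_eqI[of scl "\<lambda>a b. bcomult ?B (a \<cdot>\<^bsub>?B\<^esub> b)"])
      show "Vector_Spaces.linear scl scl (\<lambda>a. bcomult ?B (a \<cdot>\<^bsub>?B\<^esub> b))"
        "Vector_Spaces.linear scl scl (\<lambda>b. bcomult ?B (a \<cdot>\<^bsub>?B\<^esub> b))" for a b
        unfolding B by (rule comp[OF linear_times_left lin] comp[OF linear_times_right lin])+
      show "Vector_Spaces.linear scl scl (\<lambda>a. bcomult ?B a \<cdot>\<^bsub>?B \<otimes>\<^sub>B ?B\<^esub> bcomult ?B b)" for b
        unfolding tensor_bialg_def bialg.simps B by (rule comp[OF lin tl])
      show "Vector_Spaces.linear scl scl (\<lambda>b. bcomult ?B a \<cdot>\<^bsub>?B \<otimes>\<^sub>B ?B\<^esub> bcomult ?B b)" for a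
        unfolding B(3) by (rule comp[OF lin T2])
    qed (simp add: tensor_bialg_def B vs basis_vec_mult tens_basis_vec)
    show "bcomult ?B \<one>\<^bsub>?B\<^esub> = \<one>\<^bsub>?B \<otimes>\<^sub>B ?B\<^esub>"
      unfolding tensor_bialg_def bialg.simps B one
      by (simp add: vs tens_basis_vec del: single_one)
    show "bcounit ?B (a \<cdot>\<^bsub>?B\<^esub> b) = bcounit ?B a * bcounit ?B b"
      unfolding B
    proof (rule bilinear_eqI[of "(*)" "\<lambda>a b. lin_ext (*) (\<lambda>g. 1) (a * b)"])
      show "Vector_Spaces.linear scl (*) (\<lambda>a. lin_ext (*) (\<lambda>g. 1) (a * b))"
        "Vector_Spaces.linear scl (*) (\<lambda>b. lin_ext (*) (\<lambda>g. 1) (a * b))"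
        for a b :: "'g \<Rightarrow>\<^sub>0 'k"
        by (rule comp[OF linear_times_left lin'] comp[OF linear_times_right lin'])+
    qed (rule linear_mult_functional[OF lin'] | simp add: vs basis_vec_mult)+
    show "bcounit ?B \<one>\<^bsub>?B\<^esub> = 1"
      unfolding B one by (simp add: vs del: single_one)
    have cl: "Vector_Spaces.linear scl scl (\<lambda>a. bcounit ?B a *\<^sub>k \<one>\<^bsub>?B\<^esub>)"
      unfolding B by (rule linear_mult_functional[OF lin'])
    show "Vector_Spaces.linear scl scl (group_antipode :: ('g \<Rightarrow>\<^sub>0 'k) \<Rightarrow> _)"
      by (simp add: group_antipode_def)
    show "tlift scl (\<lambda>u v. group_antipode u \<cdot>\<^bsub>?B\<^esub> v) (bcomult ?B a) = bcounit ?B a *\<^sub>k \<one>\<^bsub>?B\<^esub>"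
      by (rule linear_eqI[of scl "\<lambda>a. tlift scl _ (bcomult ?B a)", OF _ cl])
        (auto intro!: comp[OF lin] simp: B vs group_antipode_def basis_vec_mult)
    show "tlift scl (\<lambda>u v. u \<cdot>\<^bsub>?B\<^esub> group_antipode v) (bcomult ?B a) = bcounit ?B a *\<^sub>k \<one>\<^bsub>?B\<^esub>"
      by (rule linear_eqI[of scl "\<lambda>a. tlift scl _ (bcomult ?B a)", OF _ cl])
        (auto intro!: comp[OF lin] simp: B vs group_antipode_def basis_vec_mult)
  qed
qed

definition primitive_root_of_unity :: "nat \<Rightarrow> 'k::field \<Rightarrow> bool"
  where "primitive_root_of_unity n q \<longleftrightarrow> q ^ n = 1 \<and> (\<forall>m. 0 < m \<and> m < n \<longrightarrow> q ^ m \<noteq> 1)"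

end

theory Submission
  imports Defs "HOL-Library.Product_Plus"
begin

text \<open>
  Tensor products of group algebras are group algebras of product groups, so all identities are
  equations in group algebras of powers of \<open>\<int>\<^sub>n\<close>, and these may be checked by applying characters.
  If \<open>\<chi>\<^sub>a\<close> is the character with \<open>\<chi>\<^sub>a(x) = q\<^sup>a\<close>, then \<open>\<chi>\<^sub>a(e\<^sub>k)\<close> is \<open>1\<close> or \<open>0\<close> according to whether
  \<open>a \<equiv> k\<close> modulo \<open>n\<close>, and so \<open>(\<chi>\<^sub>a \<otimes> \<chi>\<^sub>b)(J) = q\<^bsup>ab\<^esup>\<close>. Since comultiplication is dual to the product
  of characters, everything follows from \<open>(a, b) \<mapsto> q\<^bsup>ab\<^esup>\<close> being a symmetric bicharacter.
\<close>

section \<open>Linear functionals given on the basis\<close>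

text \<open>The pairing of a space with its dual, the functions on the basis. The lemmas below carry
  each structure map across it to a transposed operation on functions.\<close>

abbreviation ev :: "('x \<Rightarrow> 'k::field) \<Rightarrow> ('x \<Rightarrow>\<^sub>0 'k) \<Rightarrow> 'k"
  where "ev \<equiv> lin_ext (*)"

definition fun_tens :: "('x \<Rightarrow> 'k::field) \<Rightarrow> ('y \<Rightarrow> 'k) \<Rightarrow> 'x \<times> 'y \<Rightarrow> 'k" (infixr \<open>\<boxtimes>\<close> 70)
  where "\<phi> \<boxtimes> \<psi> = (\<lambda>(a, b). \<phi> a * \<psi> b)"

lemma fun_tens_apply [simp]: "(\<phi> \<boxtimes> \<psi>) (a, b) = \<phi> a * \<psi> b"
  by (simp add: fun_tens_def)

lemmas linear_ev = linear_lin_ext[OF vector_space_field]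

lemma ev_basis_vec [simp]: "ev \<phi> (basis_vec a) = \<phi> a"
  by (rule lin_ext_basis_vec[OF vector_space_field])

lemma ev_add: "ev \<phi> (p + r) = ev \<phi> p + ev \<phi> r"
  and ev_scl: "ev \<phi> (c *\<^sub>k p) = c * ev \<phi> p"
  using linear_ev[of \<phi>] unfolding Vector_Spaces.linear_iff by blast+

lemma ev_zero: "ev \<phi> 0 = 0"
  by (simp add: lin_ext_def)

lemma ev_sum: "ev \<phi> (\<Sum>i\<in>A. f i) = (\<Sum>i\<in>A. ev \<phi> (f i))"
  by (induction A rule: infinite_finite_induct) (simp_all add: ev_add ev_zero)

lemma ev_diff: "ev \<phi> (p - r) = ev \<phi> p - ev \<phi> r"
  using ev_add[of \<phi> "p - r" r] by simp

lemma ev_linear: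
  assumes "Vector_Spaces.linear scl scl T"
  shows "ev \<phi> (T p) = ev (\<lambda>a. ev \<phi> (T (basis_vec a))) p"
  using linear_eq_lin_ext[OF Vector_Spaces.linear_compose[OF assms linear_ev], of \<phi> p]
  unfolding o_def .

lemma ev_lin_ext: "ev \<phi> (lin_ext scl f p) = ev (\<lambda>a. ev \<phi> (f a)) p"
  by (subst ev_linear[OF linear_lin_ext[OF vector_space_scl]])
    (simp add: lin_ext_basis_vec[OF vector_space_scl])

lemma ev_tlift:
  "ev \<phi> (tlift scl \<beta> p) = ev (\<lambda>(a, b). ev \<phi> (\<beta> (basis_vec a) (basis_vec b))) p"
  by (simp add: tlift_def ev_lin_ext case_prod_unfold)

lemma ev_fun_tens_tens [simp]: "ev (\<phi> \<boxtimes> \<psi>) (u \<otimes> v) = ev \<phi> u * ev \<psi> v"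
proof (rule bilinear_eqI[of "(*)" "\<lambda>u v. ev (\<phi> \<boxtimes> \<psi>) (u \<otimes> v)"])
  note comp = Vector_Spaces.linear_compose[unfolded o_def]
  show "Vector_Spaces.linear scl (*) (\<lambda>u. ev (\<phi> \<boxtimes> \<psi>) (u \<otimes> v))"
    "Vector_Spaces.linear scl (*) (\<lambda>v. ev (\<phi> \<boxtimes> \<psi>) (u \<otimes> v))" for u v
    by (rule comp[OF linear_tens_left linear_ev] comp[OF linear_tens_right linear_ev])+
qed (simp_all add: linear_mult_functional linear_ev tens_basis_vec)

text \<open>The transpose of a tensor product of maps is the tensor product of the transposes;
  \<open>tmap\<close> reads \<open>f\<close> and \<open>g\<close> on basis vectors, so these values
  determine it.\<close>

lemma ev_tmap:
  "ev (\<phi> \<boxtimes> \<psi>) (tmap f g p) =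
    ev ((\<lambda>a. ev \<phi> (f (basis_vec a))) \<boxtimes> (\<lambda>b. ev \<psi> (g (basis_vec b)))) p"
  by (simp add: tmap_def ev_tlift flip: fun_tens_def)

lemma ev_tassoc: "ev (\<phi> \<boxtimes> \<psi> \<boxtimes> \<omega>) (tassoc p) = ev ((\<phi> \<boxtimes> \<psi>) \<boxtimes> \<omega>) p"
proof -
  have "(\<phi> \<boxtimes> \<psi>) \<boxtimes> \<omega> = (\<lambda>(s, c). \<phi> (fst s) * (\<psi> (snd s) * \<omega> c))"
    by (auto simp: fun_tens_def mult.assoc)
  moreover have "ev (\<phi> \<boxtimes> \<psi> \<boxtimes> \<omega>)
      (tlift scl (\<lambda>u v. u \<otimes> v \<otimes> basis_vec c) (basis_vec s)) = \<phi> (fst s) * (\<psi> (snd s) * \<omega> c)"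
    for s c
    by (cases s) (simp add: vector_space_scl)
  ultimately show ?thesis
    by (simp add: tassoc_def ev_tlift)
qed

section \<open>Tensor products of group algebras\<close>

lemma bmult_group_algebra [simp]: "bmult group_algebra = (*)"
  and bunit_group_algebra [simp]: "bunit group_algebra = 1"
  and bcounit_group_algebra: "bcounit group_algebra = ev (\<lambda>_. 1)"
  by (simp_all add: group_algebra_def)

lemma bcomult_group_algebra: "bcomult group_algebra = lin_ext scl (\<lambda>h. basis_vec (h, h))"
  by (simp add: group_algebra_def tens_basis_vec)

lemma bcomult_basis_vec [simp]: "bcomult group_algebra (basis_vec h) = basis_vec (h, h)"
  by (simp add: bcomult_group_algebra vector_space_scl)

text \<open>Group elements are group-like, so the transpose of comultiplication is the pointwise
  product of functions.\<close>

lemma ev_bcomult: "ev (\<phi> \<boxtimes> \<psi>) (bcomult group_algebra p) = ev (\<lambda>h. \<phi> h * \<psi> h) p"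
  by (simp add: bcomult_group_algebra ev_lin_ext)

lemma ev_group_antipode: "ev \<phi> (group_antipode p) = ev (\<lambda>h. \<phi> (- h)) p"
  by (simp add: group_antipode_def ev_lin_ext)

lemma tens_one_one: "(1 :: 'g::zero \<Rightarrow>\<^sub>0 'k::field) \<otimes> (1 :: 'h::zero \<Rightarrow>\<^sub>0 'k) = 1"
  using tens_basis_vec[of "0::'g" "0::'h"] by (simp add: zero_prod_def[symmetric])

text \<open>Pure tensors of group elements are the elements of the product group, and all structure
  maps agree on them. The equality is literal, so products in iterated tensor powers become the
  convolution \<open>*\<close>.\<close>

theorem tensor_group_algebra:
  "(group_algebra :: ('g::group_add, 'k::field) bialg) \<otimes>\<^sub>B (group_algebra :: ('h::group_add, 'k) bialg)
    = group_algebra"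
    (is "?A \<otimes>\<^sub>B ?B = ?C")
proof (rule bialg.equality)
  note comp = Vector_Spaces.linear_compose[unfolded o_def]
  note vs = vector_space_scl vector_space_field
  note tl = linear_tlift[OF vector_space_scl]
  show "bmult (?A \<otimes>\<^sub>B ?B) = bmult ?C"
  proof (intro ext)
    fix s t :: "'g \<times> 'h \<Rightarrow>\<^sub>0 'k"
    show "bmult (?A \<otimes>\<^sub>B ?B) s t = bmult ?C s t"
    proof (rule bilinear_eqI[of scl "bmult (?A \<otimes>\<^sub>B ?B)" "bmult ?C"])
      show "Vector_Spaces.linear scl scl (\<lambda>s. bmult (?A \<otimes>\<^sub>B ?B) s t)"
        "Vector_Spaces.linear scl scl (bmult (?A \<otimes>\<^sub>B ?B) s)" for s t
        unfolding tensor_bialg_def bialg.simps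
        by (rule tl linear_tlift_param[OF vector_space_scl vector_space_scl tl])+
      show "bmult (?A \<otimes>\<^sub>B ?B) (basis_vec a) (basis_vec b) = bmult ?C (basis_vec a) (basis_vec b)"
        for a b :: "'g \<times> 'h"
        by (cases a; cases b)
          (simp add: tensor_bialg_def vs basis_vec_mult tens_basis_vec)
    qed (simp_all add: linear_times_left linear_times_right)
  qed
  show "bunit (?A \<otimes>\<^sub>B ?B) = bunit ?C"
    by (simp add: tensor_bialg_def tens_one_one)
  show "bcomult (?A \<otimes>\<^sub>B ?B) = bcomult ?C"
  proof
    fix p :: "'g \<times> 'h \<Rightarrow>\<^sub>0 'k"
    show "bcomult (?A \<otimes>\<^sub>B ?B) p = bcomult ?C p"
    proof (rule linear_eqI[of scl "bcomult (?A \<otimes>\<^sub>B ?B)" "bcomult ?C"])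
      show "Vector_Spaces.linear scl scl (bcomult (?A \<otimes>\<^sub>B ?B))"
        unfolding tensor_bialg_def bialg.simps mid_flip_def tmap_def by (rule comp[OF tl tl])
      show "Vector_Spaces.linear scl scl (bcomult ?C)"
        unfolding bcomult_group_algebra by (rule linear_lin_ext[OF vector_space_scl])
      show "bcomult (?A \<otimes>\<^sub>B ?B) (basis_vec a) = bcomult ?C (basis_vec a)" for a
        by (cases a) (simp add: tensor_bialg_def mid_flip_def tmap_def vs tens_basis_vec)
    qed
  qed
  show "bcounit (?A \<otimes>\<^sub>B ?B) = bcounit ?C"
    by (simp add: tensor_bialg_def bcounit_group_algebra tlift_def case_prod_unfold)
qed simp

section \<open>Bicharacters and twists\<close>

definition is_character :: "('g::group_add \<Rightarrow> 'k::field) \<Rightarrow> bool"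
  where "is_character \<chi> \<longleftrightarrow> \<chi> 0 = 1 \<and> (\<forall>a b. \<chi> (a + b) = \<chi> a * \<chi> b)"

lemma ev_mult:
  assumes "is_character \<chi>"
  shows "ev \<chi> (p * r) = ev \<chi> p * ev \<chi> r"
proof (rule bilinear_eqI[of "(*)" "\<lambda>p r. ev \<chi> (p * r)"])
  note comp = Vector_Spaces.linear_compose[unfolded o_def]
  show "Vector_Spaces.linear scl (*) (\<lambda>p. ev \<chi> (p * r))"
    "Vector_Spaces.linear scl (*) (\<lambda>r. ev \<chi> (p * r))" for p r
    by (rule comp[OF linear_times_left linear_ev] comp[OF linear_times_right linear_ev])+
qed (use assms in \<open>simp_all add: linear_mult_functional linear_ev basis_vec_mult is_character_def\<close>)

lemma ev_one: "is_character \<chi> \<Longrightarrow> ev \<chi> 1 = 1"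
  using ev_basis_vec[of \<chi> 0] by (simp add: is_character_def)

lemma is_character_fun_tens: "is_character \<phi> \<Longrightarrow> is_character \<psi> \<Longrightarrow> is_character (\<phi> \<boxtimes> \<psi>)"
  by (simp add: is_character_def fun_tens_def case_prod_unfold)

text \<open>A stand-in for the dual group: index addition is the product of characters, and together
  the characters detect every element. Indices may repeat a character, as integers do for a finite
  cyclic group.\<close>

locale separating_characters =
  fixes \<chi> :: "'i::group_add \<Rightarrow> 'g::group_add \<Rightarrow> 'k::field"
  assumes character: "is_character (\<chi> i)"
    and index_zero: "\<chi> 0 a = 1"
    and index_add: "\<chi> (i + j) a = \<chi> i a * \<chi> j a"
    and separating: "(\<And>i. ev (\<chi> i) p = 0) \<Longrightarrow> p = 0"
begin

lemma eqI: "(\<And>i. ev (\<chi> i) p = ev (\<chi> i) r) \<Longrightarrow> p = r"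
  using separating[of "p - r"] by (simp add: ev_diff)

lemma index_mult: "(\<lambda>a. \<chi> i a * \<chi> j a) = \<chi> (i + j)"
  by (rule ext) (simp add: index_add)

text \<open>Both sides are inverse to \<open>\<chi> i a\<close>. Hence the antipode acts on
  characters by negating the index.\<close>

lemma neg: "(\<lambda>a. \<chi> i (- a)) = \<chi> (- i)"
proof
  fix a
  have "\<chi> i a * \<chi> i (- a) = 1" "\<chi> i a * \<chi> (- i) a = 1"
    using character[of i] index_zero index_add[of i "- i" a]
    unfolding is_character_def by (metis right_minus)+
  then show "\<chi> i (- a) = \<chi> (- i) a"
    by (metis mult_cancel_left mult_zero_left zero_neq_one)
qed

end

text \<open>The factors are separated one after the other: first the characters of the left factor,
  then those of the right.\<close>

lemma separating_characters_prod:
  assumes "separating_characters \<chi>" "separating_characters \<chi>'"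
  shows "separating_characters (\<lambda>(i, j). \<chi> i \<boxtimes> \<chi>' j)"
proof -
  interpret A: separating_characters \<chi> by fact
  interpret B: separating_characters \<chi>' by fact
  show ?thesis
  proof
    fix i
    show "is_character ((\<lambda>(i, j). \<chi> i \<boxtimes> \<chi>' j) i)"
      by (simp add: case_prod_unfold is_character_fun_tens A.character B.character)
  next
    fix p assume p: "\<And>i. ev ((\<lambda>(i, j). \<chi> i \<boxtimes> \<chi>' j) i) p = 0"
    \<comment> \<open>\<open>left j\<close> contracts the second leg of \<open>p\<close> with
      \<open>\<chi>' j\<close>, and \<open>right a\<close> is the row of \<open>p\<close> at
      \<open>a\<close>. The coefficient of \<open>left j\<close> at \<open>a\<close> is
      \<open>\<chi>' j\<close> applied to that row, so the vanishing of every \<open>left j\<close>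
      forces every row to vanish.\<close>
    define left where "left j = lin_ext scl (\<lambda>(a, b). \<chi>' j b *\<^sub>k basis_vec a) p" for j
    define right where
      "right a = lin_ext scl (\<lambda>(a', b). if a' = a then basis_vec b else 0) p" for a
    have "ev (\<chi> i) (left j) = ev (\<chi> i \<boxtimes> \<chi>' j) p" for i j
      by (simp add: left_def ev_lin_ext case_prod_unfold ev_scl fun_tens_def mult.commute)
    then have "left j = 0" for j
      using p[of "(_, j)"] by (intro A.separating) simp
    moreover have "ev (\<chi>' j) (right a) = Poly_Mapping.lookup (left j) a" for j a
      unfolding right_def left_def ev_lin_ext lin_ext_def[of _ _ p] ev_sum ev_scl lookup_sum lookup_scl
      by (rule sum.cong) (auto simp: ev_zero lookup_single when_def split: if_splits)
    ultimately have right: "right a = 0" for a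
      by (intro B.separating) simp
    show "p = 0"
    proof (rule poly_mapping_eqI, clarify)
      fix a b
      have "Poly_Mapping.lookup (right a) b =
          (\<Sum>c\<in>Poly_Mapping.keys p. if c = (a, b) then Poly_Mapping.lookup p c else 0)"
        unfolding right_def lin_ext_def lookup_sum
        by (rule sum.cong) (auto simp: lookup_single when_def split: if_splits)
      then show "Poly_Mapping.lookup p (a, b) = Poly_Mapping.lookup 0 (a, b)"
        by (simp add: right in_keys_iff split: if_splits)
    qed
  qed (auto simp: zero_prod_def A.index_zero B.index_zero A.index_add B.index_add)
qed

section \<open>Twists from bicharacters\<close>

text \<open>\<open>\<beta>\<close> is the Fourier transform of \<open>J\<close>, which by separation
  determines \<open>J\<close>. Requiring it to be a bicharacter turns each twist axiom into an
  identity between values of \<open>\<beta>\<close>.\<close>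

locale bicharacter = separating_characters \<chi>
  for \<chi> :: "'i::group_add \<Rightarrow> 'g::group_add \<Rightarrow> 'k::field" +
  fixes \<beta> :: "'i \<Rightarrow> 'i \<Rightarrow> 'k" and J :: "'g \<times> 'g \<Rightarrow>\<^sub>0 'k"
  assumes ev_J: "ev (\<chi> i \<boxtimes> \<chi> j) J = \<beta> i j"
    and add_left: "\<beta> (i + i') j = \<beta> i j * \<beta> i' j"
    and add_right: "\<beta> i (j + j') = \<beta> i j * \<beta> i j'"
    and zero_left: "\<beta> 0 j = 1"
    and zero_right: "\<beta> i 0 = 1"
begin

interpretation P2: separating_characters "\<lambda>(i, j). \<chi> i \<boxtimes> \<chi> j"
  by (intro separating_characters_prod separating_characters_axioms)

text \<open>The nested \<open>case\<close> follows the bracketing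
  \<open>B \<otimes> (B \<otimes> B)\<close>, the target of \<open>tassoc\<close>, where the cocycle
  condition is compared.\<close>

interpretation P3: separating_characters "\<lambda>(i, j). \<chi> i \<boxtimes> (case j of (j, k) \<Rightarrow> \<chi> j \<boxtimes> \<chi> k)"
  by (intro separating_characters_prod separating_characters_axioms P2.separating_characters_axioms)

lemmas char_simps = ev_mult ev_one is_character_fun_tens character ev_tmap ev_tassoc ev_bcomult
  ev_group_antipode index_mult neg ev_J

lemma neg_left: "\<beta> (- i) j * \<beta> i j = 1" "\<beta> i j * \<beta> (- i) j = 1"
  and neg_right: "\<beta> i (- j) * \<beta> i j = 1" "\<beta> i j * \<beta> i (- j) = 1"
  using add_left[of "- i" i j] add_right[of i "- j" j]
  by (simp_all add: zero_left zero_right mult.commute)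

lemma antipode_both: "tmap group_antipode group_antipode J = J"
proof (rule P2.eqI)
  fix i
  \<comment> \<open>Negating either index inverts the value, so \<open>\<beta> (- i) (- j)\<close>
    and \<open>\<beta> i j\<close> are both inverse to \<open>\<beta> (- i) j\<close>.\<close>
  have "\<beta> (- i) (- j) * \<beta> (- i) j = 1" "\<beta> i j * \<beta> (- i) j = 1" for i j
    by (rule neg_right neg_left)+
  then have "\<beta> (- i) (- j) = \<beta> i j" for i j
    by (metis mult_cancel_right mult_zero_right zero_neq_one)
  then show "ev (case i of (i, j) \<Rightarrow> \<chi> i \<boxtimes> \<chi> j) (tmap group_antipode group_antipode J) =
      ev (case i of (i, j) \<Rightarrow> \<chi> i \<boxtimes> \<chi> j) J"
    by (cases i) (simp add: char_simps)
qed

text \<open>At characters \<open>i\<close> and \<open>j\<close> the candidate inverse takes the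
  value \<open>\<beta> i (- j)\<close>, the inverse of \<open>\<beta> i j\<close>.\<close>

lemma inverse_antipode_right: "is_inverse (group_algebra \<otimes>\<^sub>B group_algebra) J (tmap id group_antipode J)"
  unfolding is_inverse_def tensor_group_algebra
  by (auto intro!: P2.eqI simp: char_simps neg_right)

lemma inverse_antipode_left: "is_inverse (group_algebra \<otimes>\<^sub>B group_algebra) J (tmap group_antipode id J)"
  unfolding is_inverse_def tensor_group_algebra
  by (auto intro!: P2.eqI simp: char_simps neg_left)

lemma counit_left: "tlift scl (\<lambda>u v. bcounit group_algebra u *\<^sub>k v) J = 1"
proof (rule eqI)
  fix i
  \<comment> \<open>The counit is the trivial character \<open>\<chi> 0\<close>, so contracting the
    first leg evaluates \<open>J\<close> at \<open>\<beta> 0 i\<close>.\<close>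
  have "(\<lambda>(a, b). \<chi> i b) = \<chi> 0 \<boxtimes> \<chi> i"
    by (auto simp: index_zero)
  then show "ev (\<chi> i) (tlift scl (\<lambda>u v. bcounit group_algebra u *\<^sub>k v) J) = ev (\<chi> i) 1"
    by (simp add: ev_tlift bcounit_group_algebra char_simps zero_left)
qed

lemma counit_right: "tlift scl (\<lambda>u v. bcounit group_algebra v *\<^sub>k u) J = 1"
proof (rule eqI)
  fix i
  have "(\<lambda>(a, b). \<chi> i a) = \<chi> i \<boxtimes> \<chi> 0"
    by (auto simp: index_zero)
  then show "ev (\<chi> i) (tlift scl (\<lambda>u v. bcounit group_algebra v *\<^sub>k u) J) = ev (\<chi> i) 1"
    by (simp add: ev_tlift bcounit_group_algebra char_simps zero_right)
qed

theorem twist: "twist group_algebra J"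
proof (intro twist.intro twist_axioms.intro)
  show "bialgebra (group_algebra :: ('g, 'k) bialg)"
    using hopf_algebra_group_algebra unfolding hopf_algebra_def by blast
  show "\<exists>J'. is_inverse (group_algebra \<otimes>\<^sub>B group_algebra) J J'"
    using inverse_antipode_right by blast
  show "tassoc (tmap (bcomult group_algebra) id J
        \<cdot>\<^bsub>(group_algebra \<otimes>\<^sub>B group_algebra) \<otimes>\<^sub>B group_algebra\<^esub> (J \<otimes> \<one>\<^bsub>group_algebra\<^esub>)) =
      tmap id (bcomult group_algebra) J
        \<cdot>\<^bsub>group_algebra \<otimes>\<^sub>B (group_algebra \<otimes>\<^sub>B group_algebra)\<^esub> (\<one>\<^bsub>group_algebra\<^esub> \<otimes> J)"
    unfolding tensor_group_algebra
    \<comment> \<open>At characters \<open>i\<close>, \<open>j\<close>, \<open>k\<close> the two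
      sides are \<open>\<beta> (i + j) k * \<beta> i j\<close> and
      \<open>\<beta> i (j + k) * \<beta> j k\<close>; both expand to
      \<open>\<beta> i j * \<beta> i k * \<beta> j k\<close>.\<close>
    by (rule P3.eqI) (auto simp: char_simps add_left add_right)
qed (simp_all add: counit_left counit_right)

text \<open>The embeddings place the legs of \<open>J\<close> in the outer two of four tensor
  factors, so only the outer indices are seen. Theorem \<open>twist\<close> then applies again with
  pairs as indices.\<close>

lemma bicharacter_e1_e2:
  "bicharacter (\<lambda>(i, j). \<chi> i \<boxtimes> \<chi> j) (\<lambda>i j. \<beta> (fst i) (snd j))
    (tmap (\<lambda>b. b \<otimes> 1) (\<lambda>b. 1 \<otimes> b) J)"
  by unfold_locales
    (auto simp: char_simps add_left add_right zero_left zero_right)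

text \<open>At the index pairs \<open>(i, j)\<close> and \<open>(k, l)\<close> the left side is
  \<open>\<beta> (i + k) (j + l)\<close>, a product of four values. The right side gives
  \<open>\<beta> i l\<close>, \<open>\<beta> j k\<close> and
  \<open>\<beta> i j * \<beta> k l\<close>; symmetry exchanges \<open>\<beta> j k\<close> with
  \<open>\<beta> k j\<close>.\<close>

theorem bcomult_eq:
  assumes sym: "\<And>i j. \<beta> i j = \<beta> j i"
  shows "bcomult (group_algebra \<otimes>\<^sub>B group_algebra) J =
    tmap (\<lambda>b. b \<otimes> 1) (\<lambda>b. 1 \<otimes> b) J * tmap (\<lambda>b. 1 \<otimes> b) (\<lambda>b. b \<otimes> 1) J * (J \<otimes> J)"
proof -
  interpret P4: separating_characters
    "\<lambda>(i, j). (case i of (i, j) \<Rightarrow> \<chi> i \<boxtimes> \<chi> j) \<boxtimes> (case j of (i, j) \<Rightarrow> \<chi> i \<boxtimes> \<chi> j)"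
    by (intro separating_characters_prod P2.separating_characters_axioms)
  have mult: "(\<lambda>h. (\<chi> i \<boxtimes> \<chi> j) h * (\<chi> k \<boxtimes> \<chi> l) h) = \<chi> (i + k) \<boxtimes> \<chi> (j + l)" for i j k l
    by (auto simp: index_add fun_tens_def)
  show ?thesis
    unfolding tensor_group_algebra
    by (rule P4.eqI) (auto simp: char_simps mult add_left add_right sym)
qed

end

section \<open>Characters of a finite cyclic group\<close>

lemma sum_root_of_unity:
  fixes r :: "'k::field"
  assumes "r ^ n = 1"
  shows "(\<Sum>i<n. r ^ i) = (if r = 1 then of_nat n else 0)"
  using assms by (simp add: geometric_sum)

lemma primitive_root_power_inj:
  assumes "primitive_root_of_unity n (q :: 'k::field)" "i < n" "j < n" "q ^ i = q ^ j"
  shows "i = j"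
proof -
  have "i = j" if "i \<le> j" "j < n" "q ^ i = q ^ j" for i j
  proof (rule ccontr)
    assume "i \<noteq> j"
    have "q \<noteq> 0"
      using assms(1,2) by (auto simp: primitive_root_of_unity_def power_0_left split: if_splits)
    then have "q ^ (j - i) = 1"
      using that by (simp add: power_diff)
    moreover have "q ^ (j - i) \<noteq> 1"
      using assms(1) that \<open>i \<noteq> j\<close> by (simp add: primitive_root_of_unity_def)
    ultimately show False by simp
  qed
  from this[of i j] this[of j i] assms show ?thesis
    by (metis nle_le)
qed

locale cyclic_group_root =
  fixes g :: "'g::group_add" and n :: nat and q :: "'k::field_char_0"
  assumes card: "card (UNIV :: 'g set) = n"
    and generates: "\<exists>i. h = ((+) g ^^ i) 0"
    and pos: "n > 0"
    and prim: "primitive_root_of_unity n q"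
begin

section \<open>Multiples of the generator and their period\<close>

definition mul :: "nat \<Rightarrow> 'g"
  where "mul i = ((+) g ^^ i) 0"

lemma mul_0 [simp]: "mul 0 = 0"
  by (simp add: mul_def)

lemma mul_add: "mul (i + j) = mul i + mul j"
  by (induction i) (simp_all add: mul_def add.assoc)

lemma mul_mult_eq_0: "mul d = 0 \<Longrightarrow> mul (d * k) = 0"
  by (induction k) (simp_all add: mul_add)

lemma mul_mod: "mul d = 0 \<Longrightarrow> mul (i mod d) = mul i"
  using mul_add[of "d * (i div d)" "i mod d"] by (simp add: mul_mult_eq_0)

lemma mul_surj: "\<exists>i. h = mul i"
  using generates by (simp add: mul_def)

text \<open>If \<open>d\<close> is a period, the multiples below \<open>d\<close> already exhaust
  the group, which has \<open>n\<close> elements.\<close>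

lemma period_ge:
  assumes "mul d = 0" "d > 0"
  shows "n \<le> d"
proof -
  have "h \<in> mul ` {..<d}" for h
    using mul_surj[of h] mul_mod[OF assms(1)] assms(2) by (metis imageI lessThan_iff mod_less_divisor)
  then have "(UNIV :: 'g set) = mul ` {..<d}" by blast
  then show ?thesis
    using card card_image_le[of "{..<d}" mul] by simp
qed

lemma mul_diff: "mul i = mul j \<Longrightarrow> i \<le> j \<Longrightarrow> mul (j - i) = 0"
  using mul_add[of "j - i" i] by (metis add_0 add_right_imp_eq le_add_diff_inverse2)

text \<open>By the pigeonhole principle two of the \<open>n + 1\<close> multiples with index up to
  \<open>n\<close> coincide. Their index difference is a period of size at most \<open>n\<close>,
  and \<open>period_ge\<close> makes it equal to \<open>n\<close>.\<close>

lemma mul_n: "mul n = 0"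
proof -
  have fin: "finite (UNIV :: 'g set)"
    using card pos card.infinite by fastforce
  have "card (mul ` {..n}) \<le> n"
    using card card_mono[OF fin subset_UNIV] by metis
  then have "\<not> inj_on mul {..n}"
    using card_image[of mul "{..n}"] by auto
  then obtain i j where "mul i = mul j" "i < j" "j \<le> n"
    unfolding inj_on_def by (metis atMost_iff linorder_neqE_nat)
  then have "mul (j - i) = 0" "n \<le> j - i"
    using mul_diff[of i j] period_ge[of "j - i"] by simp_all
  moreover have "j - i = n"
    using \<open>n \<le> j - i\<close> \<open>j \<le> n\<close> by simp
  ultimately show ?thesis by simp
qed

lemma bij_mul: "bij_betw mul {..<n} UNIV"
proof -
  have "UNIV = mul ` {..<n}"
    using mul_surj mul_mod[OF mul_n] pos by (metis UNIV_eq_I imageI lessThan_iff mod_less_divisor)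
  then show ?thesis
    using card by (simp add: bij_betw_def eq_card_imp_inj_on)
qed

lemma q_nonzero: "q \<noteq> 0" and q_power_n: "q ^ n = 1"
  using prim pos by (auto simp: primitive_root_of_unity_def power_0_left)

lemma q_power_mod: "q ^ (i mod n) = q ^ i"
proof -
  have "q ^ i = q ^ (n * (i div n) + i mod n)" by simp
  also have "\<dots> = q ^ (i mod n)"
    by (simp only: power_add power_mult q_power_n) simp
  finally show ?thesis by simp
qed

lemma q_power_cong: "mul i = mul j \<Longrightarrow> q ^ i = q ^ j"
  using bij_mul pos mul_mod[OF mul_n] q_power_mod
  by (metis bij_betw_imp_inj_on inj_onD lessThan_iff mod_less_divisor)

section \<open>Characters of the cyclic group and Fourier inversion\<close>

text \<open>The choice of exponent is harmless by \<open>q_power_cong\<close>. Integer indices make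
  inverse characters available and let indices be multiplied in the exponent of
  \<open>q\<close>.\<close>

definition char :: "int \<Rightarrow> 'g \<Rightarrow> 'k"
  where "char a h = (q ^ (SOME i. h = mul i)) powi a"

lemma char_mul: "char a (mul i) = (q powi a) ^ i"
proof -
  have "q ^ (SOME j. mul i = mul j) = q ^ i"
    by (rule q_power_cong) (metis (mono_tags) someI)
  then have "char a (mul i) = (q powi int i) powi a"
    by (simp add: char_def)
  then show ?thesis
    by (metis mult.commute power_int_mult power_int_of_nat)
qed

lemma q_powi_power_n: "(q powi a) ^ n = 1"
  by (metis mult.commute power_int_1_left power_int_mult power_int_of_nat q_power_n)

lemma is_character_char: "is_character (char a)"
proof -
  have "char a (b + c) = char a b * char a c" for b c
    using mul_surj[of b] mul_surj[of c] by (auto simp flip: mul_add simp: char_mul power_add)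
  moreover have "char a 0 = 1"
    using char_mul[of a 0] by simp
  ultimately show ?thesis by (simp add: is_character_def)
qed

text \<open>Fourier inversion recovers the coefficients of \<open>p\<close>.\<close>

lemma separating_characters_char: "separating_characters char"
proof
  show "is_character (char a)" for a by (rule is_character_char)
  show "char 0 h = 1" "char (a + b) h = char a h * char b h" for a b h
    using q_nonzero by (simp_all add: char_def power_int_add)
  fix p assume p: "\<And>a. ev (char a) p = 0"
  show "p = 0"
  proof (rule poly_mapping_eqI)
    fix h
    obtain j where j: "j < n" "h = mul j"
      using bij_mul by (metis UNIV_I bij_betw_imp_surj_on imageE lessThan_iff)
    have fin: "finite (UNIV :: 'g set)"
      using card pos card.infinite by fastforce
    have ev: "ev (char a) p = (\<Sum>i<n. Poly_Mapping.lookup p (mul i) * (q powi a) ^ i)" for a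
      using lin_ext_superset[OF vector_space_field fin subset_UNIV, of "char a" p]
        sum.reindex_bij_betw[OF bij_mul, of "\<lambda>h. Poly_Mapping.lookup p h * char a h"]
      by (simp add: char_mul)
    \<comment> \<open>Orthogonality of characters: the summands are the powers of
      \<open>q powi (int i - int j)\<close>, an \<open>n\<close>th root of unity that equals
      \<open>1\<close> exactly when \<open>i = j\<close>.\<close>
    have orth: "(\<Sum>k<n. q powi (- (int j * int k)) * (q powi int k) ^ i) = (if i = j then of_nat n else 0)"
      if "i < n" for i
    proof -
      have "q powi (- (int j * int k)) * (q powi int k) ^ i = (q powi (int i - int j)) ^ k" for k
      proof -
        have "q powi (- (int j * int k)) * (q powi int k) ^ i
            = q powi (- (int j * int k)) * q powi (int k * int i)"
          by (simp add: power_int_mult)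
        also have "\<dots> = q powi ((int i - int j) * int k)"
          using q_nonzero by (simp add: algebra_simps flip: power_int_add)
        also have "\<dots> = (q powi (int i - int j)) ^ k"
          by (metis power_int_mult power_int_of_nat)
        finally show ?thesis .
      qed
      moreover have "q powi (int i - int j) = 1 \<longleftrightarrow> i = j"
        using primitive_root_power_inj[OF prim that j(1)] q_nonzero
        by (auto simp: power_int_diff)
      ultimately show ?thesis
        by (simp add: sum_root_of_unity q_powi_power_n)
    qed
    \<comment> \<open>The weights isolate the coefficient at \<open>h = mul j\<close>, multiplied by
      \<open>n\<close>, which is nonzero in characteristic zero.\<close>
    have "0 = (\<Sum>k<n. q powi (- (int j * int k)) * ev (char (int k)) p)"
      by (simp add: p)
    also have "\<dots> = (\<Sum>k<n. \<Sum>i<n. Poly_Mapping.lookup p (mul i) *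
        (q powi (- (int j * int k)) * (q powi int k) ^ i))"
      unfolding ev by (simp only: sum_distrib_left mult.left_commute)
    also have "\<dots> = (\<Sum>i<n. Poly_Mapping.lookup p (mul i) *
        (\<Sum>k<n. q powi (- (int j * int k)) * (q powi int k) ^ i))"
      by (subst sum.swap) (simp only: sum_distrib_left)
    also have "\<dots> = (\<Sum>i<n. if i = j then Poly_Mapping.lookup p (mul i) * of_nat n else 0)"
      by (rule sum.cong) (simp_all add: orth del: power_int_of_nat)
    also have "\<dots> = Poly_Mapping.lookup p h * of_nat n"
      using j by simp
    finally show "Poly_Mapping.lookup p h = Poly_Mapping.lookup 0 h"
      using pos by simp
  qed
qed

section \<open>The idempotents and the Fourier transform of the twist\<close>

definition idem :: "nat \<Rightarrow> 'g \<Rightarrow>\<^sub>0 'k"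
  where "idem k = (1 / of_nat n) *\<^sub>k (\<Sum>i<n. (q powi (- int (i * k))) *\<^sub>k basis_vec g ^ i)"

lemma basis_vec_power: "basis_vec g ^ i = (basis_vec (mul i) :: 'g \<Rightarrow>\<^sub>0 'k)"
  by (induction i) (simp_all add: mul_def basis_vec_mult)

text \<open>The evaluation is a geometric sum with ratio \<open>q powi (a - int k)\<close>, which is
  \<open>n\<close> or \<open>0\<close> before normalization.\<close>

lemma ev_char_idem: "ev (char a) (idem k) = (if q powi a = q ^ k then 1 else 0)"
proof -
  have "q powi (- int (i * k)) * (q powi a) ^ i = (q powi (a - int k)) ^ i" for i
  proof -
    have "(q powi (a - int k)) ^ i = q powi ((a - int k) * int i)"
      by (metis power_int_mult power_int_of_nat)
    also have "\<dots> = q powi (- int (i * k) + a * int i)"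
      by (simp add: algebra_simps)
    also have "\<dots> = q powi (- int (i * k)) * q powi (a * int i)"
      by (simp only: power_int_add[OF disjI1[OF q_nonzero]])
    also have "q powi (a * int i) = (q powi a) ^ i"
      by (metis power_int_mult power_int_of_nat)
    finally show ?thesis by simp
  qed
  then have "ev (char a) (idem k) = 1 / of_nat n * (\<Sum>i<n. (q powi (a - int k)) ^ i)"
    by (simp only: idem_def ev_scl ev_sum basis_vec_power ev_basis_vec char_mul)
  also have "\<dots> = (if q powi (a - int k) = 1 then 1 else 0)"
    using pos by (simp add: sum_root_of_unity q_powi_power_n)
  finally show ?thesis
    using q_nonzero by (simp add: power_int_diff)
qed

lemma q_powi_mod: "q ^ nat (a mod int n) = q powi a"
proof -
  have "q powi a = q powi (int n * (a div int n) + a mod int n)" by simp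
  also have "\<dots> = q powi (a mod int n)"
    by (simp only: power_int_add[OF disjI1[OF q_nonzero]] power_int_mult power_int_of_nat q_power_n)
      simp
  also have "\<dots> = q ^ nat (a mod int n)"
    using pos by (simp add: power_int_def)
  finally show ?thesis by simp
qed

lemma ev_char_twist:
  "ev (char a \<boxtimes> char b) (\<Sum>k<n. idem k \<otimes> basis_vec g ^ k) = q powi (a * b)"
proof -
  \<comment> \<open>\<open>r\<close> is the residue of \<open>a\<close> in the summation range. By
    primitivity it is the only index whose idempotent survives under \<open>char a\<close>.\<close>
  define r where "r = nat (a mod int n)"
  have r: "r < n" "q powi a = q ^ r"
    using pos by (simp_all add: r_def q_powi_mod nat_less_iff)
  have "ev (char a \<boxtimes> char b) (\<Sum>k<n. idem k \<otimes> basis_vec g ^ k)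
      = (\<Sum>k<n. if r = k then (q powi b) ^ k else 0)"
    unfolding ev_sum
    by (rule sum.cong)
      (use primitive_root_power_inj[OF prim r(1)]
        in \<open>auto simp: ev_char_idem basis_vec_power char_mul r\<close>)
  also have "\<dots> = (q powi b) ^ r"
    using r by simp
  also have "\<dots> = (q ^ r) powi b"
    by (metis mult.commute power_int_mult power_int_of_nat)
  also have "\<dots> = q powi (a * b)"
    by (simp add: r power_int_mult flip: r(2))
  finally show ?thesis .
qed

lemma bicharacter_twist:
  "bicharacter char (\<lambda>a b. q powi (a * b)) (\<Sum>k<n. idem k \<otimes> basis_vec g ^ k)"
  by (intro bicharacter.intro bicharacter_axioms.intro separating_characters_char)
    (use q_nonzero in \<open>simp_all add: ev_char_twist distrib_left distrib_right power_int_add\<close>)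

end

theorem lemma7:
  fixes n :: nat
    and q :: "'k::field_char_0"
    and g :: "'g::group_add"
    and B :: "('g, 'k) bialg"
    and S :: "('g \<Rightarrow>\<^sub>0 'k) \<Rightarrow> ('g \<Rightarrow>\<^sub>0 'k)"
    and x :: "'g \<Rightarrow>\<^sub>0 'k"
    and e :: "nat \<Rightarrow> ('g \<Rightarrow>\<^sub>0 'k)"
    and J :: "'g \<times> 'g \<Rightarrow>\<^sub>0 'k"
    and e1 e2 :: "('g \<Rightarrow>\<^sub>0 'k) \<Rightarrow> ('g \<times> 'g \<Rightarrow>\<^sub>0 'k)"
  assumes "n \<ge> 2"
    and "primitive_root_of_unity n q"
    and "card (UNIV :: 'g set) = n"
    and "\<forall>h. \<exists>i. h = ((+) g ^^ i) 0"
    and "B = group_algebra"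
    and "S = group_antipode"
    and "x = basis_vec g"
    and "\<And>k. e k = (1 / of_nat n) *\<^sub>k (\<Sum>i<n. (q powi (- int (i * k))) *\<^sub>k x ^ i)"
    and "J = (\<Sum>k<n. e k \<otimes> x ^ k)"
    and "\<And>b. e1 b = b \<otimes> \<one>\<^bsub>B\<^esub>"
    and "\<And>b. e2 b = \<one>\<^bsub>B\<^esub> \<otimes> b"
  shows "twist B J
    \<and> twist (B \<otimes>\<^sub>B B) (tmap e1 e2 J)
    \<and> bcomult (B \<otimes>\<^sub>B B) J =
      tmap e1 e2 J \<cdot>\<^bsub>(B \<otimes>\<^sub>B B) \<otimes>\<^sub>B (B \<otimes>\<^sub>B B)\<^esub> tmap e2 e1 J
        \<cdot>\<^bsub>(B \<otimes>\<^sub>B B) \<otimes>\<^sub>B (B \<otimes>\<^sub>B B)\<^esub> (J \<otimes> J)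
    \<and> tmap S S J = J
    \<and> is_inverse (B \<otimes>\<^sub>B B) J (tmap id S J)
    \<and> is_inverse (B \<otimes>\<^sub>B B) J (tmap S id J)"
proof -
  have "n > 0"
    using assms(1) by simp
  with assms(2-4) interpret cyclic_group_root g n q
    by unfold_locales auto
  have J: "J = (\<Sum>k<n. idem k \<otimes> basis_vec g ^ k)"
    unfolding assms(9) assms(8) assms(7) idem_def ..
  interpret J: bicharacter char "\<lambda>a b. q powi (a * b)" J
    unfolding J by (rule bicharacter_twist)
  interpret J2: bicharacter "\<lambda>(i, j). char i \<boxtimes> char j" "\<lambda>i j. q powi (fst i * snd j)"
    "tmap (\<lambda>b. b \<otimes> 1) (\<lambda>b. 1 \<otimes> b) J"
    by (rule J.bicharacter_e1_e2)
  have e: "e1 = (\<lambda>b. b \<otimes> 1)" "e2 = (\<lambda>b. 1 \<otimes> b)"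
    by (simp_all add: fun_eq_iff assms(5,10,11))
  show ?thesis
    unfolding e assms(5,6)
    \<comment> \<open>\<open>arg_cong[OF mult.commute]\<close> supplies the symmetry of the
      bicharacter from \<open>a * b = b * a\<close> in the exponent;
      \<open>tensor_group_algebra\<close> identifies all tensor powers with group algebras.\<close>
    using J.twist J2.twist J.bcomult_eq[OF arg_cong[OF mult.commute]] J.antipode_both
      J.inverse_antipode_left J.inverse_antipode_right
    by (simp add: tensor_group_algebra)
qed

end
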